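(* Let $\mathbb{K}=\mathbb{R}$ or $\mathbb{K}=\mathbb{C}$ and let $(H,\langle\cdot,\cdot\rangle)$ be an inner product space over $\mathbb{K}$. Let $x,e\in H$ with $\|e\|=1$ and let $\delta,\Delta\in\mathbb{K}$ with $\delta\ne\Delta$. Then $$\operatorname{Re}\langle \Delta e-x,\,x-\delta e\rangle\ge 0$$ if and only if $$\left\|x-\frac{\delta+\Delta}{2}e\right\|\le\frac12|\Delta-\delta|.$$
   Context: Inner products are linear in the first argument and conjugate-linear in the second; $\|x\|=\langle x,x\rangle^{1/2}$. *)

theory Defs
  imports "HOL-Analysis.Inner_Product"
begin

text \<open>
  Real inner product spaces are the class \<open>real_inner\<close> of the library. Complex ones are set up
  purely algebraically, and their norm is a defined function \<open>cnorm\<close> rather than the overloaded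
  \<open>norm\<close>, which would presuppose a normed vector space over the reals.
\<close>

class complex_vector = ab_group_add +
  fixes scaleC :: "complex \<Rightarrow> 'a \<Rightarrow> 'a" (infixr \<open>*\<^sub>C\<close> 75)
  assumes scaleC_add_right: "a *\<^sub>C (x + y) = a *\<^sub>C x + a *\<^sub>C y"
    and scaleC_add_left: "(a + b) *\<^sub>C x = a *\<^sub>C x + b *\<^sub>C x"
    and scaleC_scaleC: "a *\<^sub>C b *\<^sub>C x = (a * b) *\<^sub>C x"
    and scaleC_one: "1 *\<^sub>C x = x"

text \<open>
  The form is linear in the first argument; conjugate-linearity in the second follows from
  \<open>cinner_commute\<close>, which also makes \<open>cinner x x\<close> real.
\<close>

class complex_inner = complex_vector +
  fixes cinner :: "'a \<Rightarrow> 'a \<Rightarrow> complex"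
  assumes cinner_commute: "cinner x y = cnj (cinner y x)"
    and cinner_add_left: "cinner (x + y) z = cinner x z + cinner y z"
    and cinner_scaleC_left: "cinner (a *\<^sub>C x) y = a * cinner x y"
    and cinner_ge_zero: "0 \<le> Re (cinner x x)"
    and cinner_eq_zero_iff: "cinner x x = 0 \<longleftrightarrow> x = 0"

definition cnorm :: "'a::complex_inner \<Rightarrow> real"
  where "cnorm x = sqrt (Re (cinner x x))"

instantiation complex :: complex_inner
begin

definition scaleC_complex_def: "scaleC a (x::complex) = a * x"

definition cinner_complex_def: "cinner x (y::complex) = x * cnj y"

instance
  by standard
    (simp_all add: scaleC_complex_def cinner_complex_def algebra_simps)

end

end

theory Submission imports Defs
begin

text \<open>
  Put \<open>u = ((\<Delta> - \<delta>) / 2) e\<close> and \<open>w = x - ((\<delta> + \<Delta>) / 2) e\<close>. Then \<open>\<Delta> e - x = u - w\<close> and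
  \<open>x - \<delta> e = u + w\<close>, and in any inner product space the real part of \<open>\<langle>u - w, u + w\<rangle>\<close> is
  \<open>\<parallel>u\<parallel>\<^sup>2 - \<parallel>w\<parallel>\<^sup>2\<close>, because the cross terms \<open>\<langle>u, w\<rangle> - \<langle>w, u\<rangle>\<close> are purely imaginary. Hence the
  real part is nonnegative exactly if \<open>\<parallel>w\<parallel> \<le> \<parallel>u\<parallel>\<close>, and \<open>\<parallel>u\<parallel> = \<bar>\<Delta> - \<delta>\<bar> / 2\<close> since \<open>e\<close> is a unit
  vector. In geometric terms this is the theorem of Thales: with the real part as real inner
  product, the segment from \<open>\<delta> e\<close> to \<open>\<Delta> e\<close> is seen from \<open>x\<close> at an angle of at least a right
  angle, or \<open>x\<close> is one of its end points, exactly if \<open>x\<close> lies in the closed ball having that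
  segment as diameter.
\<close>

lemma inner_diff_add_nonneg_iff:
  fixes u w :: "'a::real_inner"
  shows "0 \<le> inner (u - w) (u + w) \<longleftrightarrow> norm w \<le> norm u"
proof -
  have "inner (u - w) (u + w) = inner u u - inner w w"
    by (simp add: inner_diff_left inner_add_right inner_commute[of w u])
  then show ?thesis
    by (simp add: norm_le)
qed

lemma cinner_add_right:
  fixes x y z :: "'a::complex_inner"
  shows "cinner x (y + z) = cinner x y + cinner x z"
  by (metis cinner_add_left cinner_commute complex_cnj_add)

lemma cinner_diff_left:
  fixes x y z :: "'a::complex_inner"
  shows "cinner (x - y) z = cinner x z - cinner y z"
  by (metis add_diff_cancel_right' cinner_add_left diff_add_cancel)

lemma cinner_scaleC_right:
  fixes x y :: "'a::complex_inner"
  shows "cinner x (a *\<^sub>C y) = cnj a * cinner x y"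
  by (metis cinner_commute cinner_scaleC_left complex_cnj_mult)

lemma cnorm_scaleC:
  fixes x :: "'a::complex_inner"
  shows "cnorm (a *\<^sub>C x) = cmod a * cnorm x"
proof -
  have "cinner (a *\<^sub>C x) (a *\<^sub>C x) = complex_of_real ((cmod a)\<^sup>2) * cinner x x"
    by (simp add: cinner_scaleC_left cinner_scaleC_right complex_norm_square mult.assoc
        del: of_real_power)
  then show ?thesis
    by (simp add: cnorm_def real_sqrt_mult del: of_real_power)
qed

lemma Re_cinner_diff_add_nonneg_iff:
  fixes u w :: "'a::complex_inner"
  shows "0 \<le> Re (cinner (u - w) (u + w)) \<longleftrightarrow> cnorm w \<le> cnorm u"
proof -
  have "Re (cinner w u) = Re (cinner u w)"
    by (metis cinner_commute cnj.sel(1))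
  then have "Re (cinner (u - w) (u + w)) = Re (cinner u u) - Re (cinner w w)"
    by (simp add: cinner_diff_left cinner_add_right)
  then show ?thesis
    by (simp add: cnorm_def)
qed

theorem corollary3:
  "(\<forall>(x::'a::real_inner) (e::'a) (\<delta>::real) (\<Delta>::real).
      norm e = 1 \<longrightarrow> \<delta> \<noteq> \<Delta> \<longrightarrow>
      (inner (\<Delta> *\<^sub>R e - x) (x - \<delta> *\<^sub>R e) \<ge> 0 \<longleftrightarrow>
       norm (x - ((\<delta> + \<Delta>) / 2) *\<^sub>R e) \<le> 1 / 2 * \<bar>\<Delta> - \<delta>\<bar>))
   \<and>
   (\<forall>(x::'b::complex_inner) (e::'b) (\<delta>::complex) (\<Delta>::complex).
      cnorm e = 1 \<longrightarrow> \<delta> \<noteq> \<Delta> \<longrightarrow>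
      (Re (cinner (\<Delta> *\<^sub>C e - x) (x - \<delta> *\<^sub>C e)) \<ge> 0 \<longleftrightarrow>
       cnorm (x - ((\<delta> + \<Delta>) / 2) *\<^sub>C e) \<le> 1 / 2 * cmod (\<Delta> - \<delta>)))"
proof (intro conjI allI impI)
  fix x e :: 'a and \<delta> \<Delta> :: real
  assume "norm e = 1"
  define u where "u = ((\<Delta> - \<delta>) / 2) *\<^sub>R e"
  define w where "w = x - ((\<delta> + \<Delta>) / 2) *\<^sub>R e"
  have "\<Delta> *\<^sub>R e = u + ((\<delta> + \<Delta>) / 2) *\<^sub>R e"
    unfolding u_def scaleR_add_left[symmetric] by (simp add: field_simps)
  then have 1: "\<Delta> *\<^sub>R e - x = u - w"
    by (simp add: w_def)
  have "((\<delta> + \<Delta>) / 2) *\<^sub>R e = u + \<delta> *\<^sub>R e"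
    unfolding u_def scaleR_add_left[symmetric] by (simp add: field_simps)
  then have 2: "x - \<delta> *\<^sub>R e = u + w"
    by (simp add: w_def)
  have "norm u = 1 / 2 * \<bar>\<Delta> - \<delta>\<bar>"
    using \<open>norm e = 1\<close> by (simp add: u_def)
  then show "inner (\<Delta> *\<^sub>R e - x) (x - \<delta> *\<^sub>R e) \<ge> 0 \<longleftrightarrow>
       norm (x - ((\<delta> + \<Delta>) / 2) *\<^sub>R e) \<le> 1 / 2 * \<bar>\<Delta> - \<delta>\<bar>"
    unfolding 1 2 w_def[symmetric] by (simp only: inner_diff_add_nonneg_iff)
next
  fix x e :: 'b and \<delta> \<Delta> :: complex
  assume "cnorm e = 1"
  define u where "u = ((\<Delta> - \<delta>) / 2) *\<^sub>C e"
  define w where "w = x - ((\<delta> + \<Delta>) / 2) *\<^sub>C e"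
  have "\<Delta> *\<^sub>C e = u + ((\<delta> + \<Delta>) / 2) *\<^sub>C e"
    unfolding u_def scaleC_add_left[symmetric] by (simp add: field_simps)
  then have 1: "\<Delta> *\<^sub>C e - x = u - w"
    by (simp add: w_def)
  have "((\<delta> + \<Delta>) / 2) *\<^sub>C e = u + \<delta> *\<^sub>C e"
    unfolding u_def scaleC_add_left[symmetric] by (simp add: field_simps)
  then have 2: "x - \<delta> *\<^sub>C e = u + w"
    by (simp add: w_def)
  have "cnorm u = 1 / 2 * cmod (\<Delta> - \<delta>)"
    using \<open>cnorm e = 1\<close> by (simp add: u_def cnorm_scaleC norm_divide)
  then show "Re (cinner (\<Delta> *\<^sub>C e - x) (x - \<delta> *\<^sub>C e)) \<ge> 0 \<longleftrightarrow>
       cnorm (x - ((\<delta> + \<Delta>) / 2) *\<^sub>C e) \<le> 1 / 2 * cmod (\<Delta> - \<delta>)"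
    unfolding 1 2 w_def[symmetric] by (simp only: Re_cinner_diff_add_nonneg_iff)
qed

end
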